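(* Let $\mathcal X,\mathcal Y,\mathcal Z$ be Polish spaces, let $(X,Y,Z)$ be random variables with values in $\mathcal X\times\mathcal Y\times\mathcal Z$, and let $U$ be an admissible generic predictor with values in the Polish space $\mathcal U$ (see context). Let $d\ge1$. Consider bounded measurable functions $h:\mathcal U\to\mathbb R^d$ and $g:\mathcal Z\to\mathbb R^d$ satisfying $$\mathbb E[h(U)\mid Y]=0,\qquad \mathbb E[g(Z)\mid Y]=0\qquad\text{almost surely}.$$ Then $$\sup_{h,g}\ \frac{\mathbb E\big[\,\big|\mathbb E[\langle h(U),g(Z)\rangle\mid Y]\big|\,\big]}{\|h\|_{L^\infty}\,\|g\|_{L^\infty}}\ \le\ \sqrt{2\,I(U;Z\mid Y)},$$ where the supremum is over all such pairs $(h,g)$ for which the denominator is nonzero.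
   Context: Polish spaces carry their Borel $\sigma$-algebras. A generic predictor $U$ is either a deterministic prediction $U=f(X,Z)$ with $f:\mathcal X\times\mathcal Z\to\mathcal Y$ measurable (so $\mathcal U=\mathcal Y$), or a revealed randomized prediction $U=(N,f(X,Z,N))$ with $N$ a noise variable in a Polish space $\mathcal N$ independent of $(X,Y,Z)$ and $f$ measurable with values in $\mathcal Y$ (so $\mathcal U=\mathcal N\times\mathcal Y$). Admissible means $I(U;Y)<\infty$ and $I(U;Z\mid Y)<\infty$. Mutual information and conditional mutual information are measure-theoretic, defined via relative entropy with natural logarithm: $I(U;Z\mid Y)=\int D_{\mathrm{KL}}(P_{U,Z\mid Y=y}\,\|\,P_{U\mid Y=y}\otimes P_{Z\mid Y=y})\,P_Y(dy)$. $\langle\cdot,\cdot\rangle$ is the Euclidean inner product on $\mathbb R^d$; $\|h\|_{L^\infty}$ and $\|g\|_{L^\infty}$ are the essential suprema of the Euclidean norms of $h(U)$ and $g(Z)$. The supremum over an empty set is taken to be $0$. *)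

theory Defs
  imports "HOL-Probability.Probability"
begin

text \<open>
  Relative entropy \<open>D(P || Q)\<close> in nats, with value \<open>\<infinity>\<close> unless \<open>P \<lless> Q\<close>. The library's
  \<^const>\<open>KL_divergence\<close> takes the reference measure first and is a Bochner integral, which is \<open>0\<close>
  for a non-integrable integrand. For probability measures the negative part of the log-density
  is always \<open>P\<close>-integrable, so non-integrability means that the divergence is \<open>\<infinity>\<close>.
\<close>
definition rel_entropy :: "'a measure \<Rightarrow> 'a measure \<Rightarrow> ennreal" where
  "rel_entropy P Q =
     (if absolutely_continuous Q P \<and> integrable P (entropy_density (exp 1) Q P)
      then ennreal (KL_divergence (exp 1) Q P) else \<infinity>)"

definition mutual_info ::
  "'w measure \<Rightarrow> ('w \<Rightarrow> 'a::second_countable_topology) \<Rightarrow> ('w \<Rightarrow> 'b::second_countable_topology) \<Rightarrow> ennreal"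
where
  "mutual_info M U Y =
     rel_entropy (distr M borel (\<lambda>\<omega>. (U \<omega>, Y \<omega>))) (distr M borel U \<Otimes>\<^sub>M distr M borel Y)"

text \<open>\<open>\<kappa>\<close> is a version of the regular conditional distribution \<open>y \<mapsto> P(W \<in> \<cdot> | Y = y)\<close>.\<close>
definition cond_law ::
  "'w measure \<Rightarrow> ('w \<Rightarrow> 'a::topological_space) \<Rightarrow> ('w \<Rightarrow> 'b::topological_space) \<Rightarrow> ('b \<Rightarrow> 'a measure) \<Rightarrow> bool"
where
  "cond_law M W Y \<kappa> \<longleftrightarrow>
     \<kappa> \<in> borel \<rightarrow>\<^sub>M prob_algebra borel \<and>
     (\<forall>A\<in>sets borel. \<forall>B\<in>sets borel.
        emeasure M {\<omega> \<in> space M. W \<omega> \<in> A \<and> Y \<omega> \<in> B} = (\<integral>\<^sup>+y\<in>B. emeasure (\<kappa> y) A \<partial>distr M borel Y))"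

text \<open>
  \<open>I(U; Z | Y)\<close>. Here \<open>\<kappa> y\<close> is the conditional law of \<open>(U, Z)\<close> given \<open>Y = y\<close>; its two marginals are
  the conditional laws of \<open>U\<close> and of \<open>Z\<close>. On Polish spaces a version \<open>\<kappa>\<close> exists and any two versions
  agree for almost every \<open>y\<close>, so the infimum ranges over a single value; it only removes the
  dependence on the choice of a version.
\<close>
definition cond_mutual_info ::
  "'w measure \<Rightarrow> ('w \<Rightarrow> 'a::second_countable_topology) \<Rightarrow> ('w \<Rightarrow> 'c::second_countable_topology)
    \<Rightarrow> ('w \<Rightarrow> 'b::second_countable_topology) \<Rightarrow> ennreal"
where
  "cond_mutual_info M U Z Y =
     (INF \<kappa>\<in>{\<kappa>. cond_law M (\<lambda>\<omega>. (U \<omega>, Z \<omega>)) Y \<kappa>}.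
        \<integral>\<^sup>+y. rel_entropy (\<kappa> y) (distr (\<kappa> y) borel fst \<Otimes>\<^sub>M distr (\<kappa> y) borel snd) \<partial>distr M borel Y)"

abbreviation sigma_gen :: "'w measure \<Rightarrow> ('w \<Rightarrow> 'y::topological_space) \<Rightarrow> 'w measure" where
  "sigma_gen M Y \<equiv> vimage_algebra (space M) Y borel"

definition deterministic_predictor ::
  "'w measure \<Rightarrow> ('w \<Rightarrow> 'x::polish_space) \<Rightarrow> ('w \<Rightarrow> 'z::polish_space) \<Rightarrow> ('w \<Rightarrow> 'y::polish_space) \<Rightarrow> bool"
where
  "deterministic_predictor M X Z U \<longleftrightarrow>
     (\<exists>f::'x \<times> 'z \<Rightarrow> 'y. f \<in> borel_measurable borel \<and> (\<forall>\<omega>\<in>space M. U \<omega> = f (X \<omega>, Z \<omega>)))"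

text \<open>
  The library's \<open>indep_var\<close> needs both variables to have the same value type, so the independence
  of \<open>N\<close> and \<open>(X, Y, Z)\<close> is expressed through the generated \<open>\<sigma>\<close>-algebras.
\<close>
definition revealed_randomized_predictor ::
  "'w measure \<Rightarrow> ('w \<Rightarrow> 'x::polish_space) \<Rightarrow> ('w \<Rightarrow> 'y::polish_space) \<Rightarrow> ('w \<Rightarrow> 'z::polish_space)
    \<Rightarrow> ('w \<Rightarrow> 'n::polish_space \<times> 'y) \<Rightarrow> bool"
where
  "revealed_randomized_predictor M X Y Z U \<longleftrightarrow>
     (\<exists>(N::'w \<Rightarrow> 'n) (f::'x \<times> 'z \<times> 'n \<Rightarrow> 'y).
        N \<in> borel_measurable M \<and> f \<in> borel_measurable borel \<and>
        prob_space.indep_set M (sets (sigma_gen M N)) (sets (sigma_gen M (\<lambda>\<omega>. (X \<omega>, Y \<omega>, Z \<omega>)))) \<and>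
        (\<forall>\<omega>\<in>space M. U \<omega> = (N \<omega>, f (X \<omega>, Z \<omega>, N \<omega>))))"

definition admissible ::
  "'w measure \<Rightarrow> ('w \<Rightarrow> 'u::second_countable_topology) \<Rightarrow> ('w \<Rightarrow> 'y::second_countable_topology)
    \<Rightarrow> ('w \<Rightarrow> 'z::second_countable_topology) \<Rightarrow> bool"
where
  "admissible M U Y Z \<longleftrightarrow> mutual_info M U Y < \<infinity> \<and> cond_mutual_info M U Z Y < \<infinity>"

definition vec_cond_exp ::
  "'w measure \<Rightarrow> 'w measure \<Rightarrow> ('w \<Rightarrow> real^'d) \<Rightarrow> 'w \<Rightarrow> real^'d" where
  "vec_cond_exp M F V \<omega> = (\<chi> i. real_cond_exp M F (\<lambda>\<omega>'. V \<omega>' $ i) \<omega>)"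

definition Linf_norm :: "'w measure \<Rightarrow> ('w \<Rightarrow> 'a::real_normed_vector) \<Rightarrow> real" where
  "Linf_norm M V = real_of_ereal (esssup M (\<lambda>\<omega>. ereal (norm (V \<omega>))))"

definition test_pairs ::
  "'w measure \<Rightarrow> ('w \<Rightarrow> 'u::topological_space) \<Rightarrow> ('w \<Rightarrow> 'y::topological_space)
    \<Rightarrow> ('w \<Rightarrow> 'z::topological_space) \<Rightarrow> (('u \<Rightarrow> real^'d) \<times> ('z \<Rightarrow> real^'d)) set"
where
  "test_pairs M U Y Z =
     {(h, g). h \<in> borel_measurable borel \<and> bounded (range h) \<and>
              g \<in> borel_measurable borel \<and> bounded (range g) \<and>
              (AE \<omega> in M. vec_cond_exp M (sigma_gen M Y) (\<lambda>\<omega>'. h (U \<omega>')) \<omega> = 0) \<and>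
              (AE \<omega> in M. vec_cond_exp M (sigma_gen M Y) (\<lambda>\<omega>'. g (Z \<omega>')) \<omega> = 0) \<and>
              Linf_norm M (\<lambda>\<omega>. h (U \<omega>)) * Linf_norm M (\<lambda>\<omega>. g (Z \<omega>)) \<noteq> 0}"

definition cond_corr_ratio ::
  "'w measure \<Rightarrow> ('w \<Rightarrow> 'u::topological_space) \<Rightarrow> ('w \<Rightarrow> 'y::topological_space)
    \<Rightarrow> ('w \<Rightarrow> 'z::topological_space) \<Rightarrow> ('u \<Rightarrow> real^'d) \<Rightarrow> ('z \<Rightarrow> real^'d) \<Rightarrow> real"
where
  "cond_corr_ratio M U Y Z h g =
     (\<integral>\<omega>. \<bar>real_cond_exp M (sigma_gen M Y) (\<lambda>\<omega>'. h (U \<omega>') \<bullet> g (Z \<omega>')) \<omega>\<bar> \<partial>M) /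
     (Linf_norm M (\<lambda>\<omega>. h (U \<omega>)) * Linf_norm M (\<lambda>\<omega>. g (Z \<omega>)))"

text \<open>
  The supremum is taken in \<^typ>\<open>ennreal\<close>, where it always exists and is \<open>0\<close> over the empty set.
  The dimension enters through the index type \<^typ>\<open>'d\<close>, carried by the first argument.
\<close>
definition cond_corr_sup ::
  "'d::finite itself \<Rightarrow> 'w measure \<Rightarrow> ('w \<Rightarrow> 'u::topological_space) \<Rightarrow> ('w \<Rightarrow> 'y::topological_space)
    \<Rightarrow> ('w \<Rightarrow> 'z::topological_space) \<Rightarrow> ennreal"
where
  "cond_corr_sup _ M U Y Z =
     (SUP (h, g) \<in> (test_pairs M U Y Z :: (('u \<Rightarrow> real^'d) \<times> ('z \<Rightarrow> real^'d)) set).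
        ennreal (cond_corr_ratio M U Y Z h g))"

end

theory Submission
  imports Defs
begin

text \<open>
  By the Donsker--Varadhan inequality and Hoeffding's lemma, a function \<open>q\<close> with \<open>\<bar>q\<bar> \<le> 1\<close> and
  \<open>E\<^sub>Q q = 0\<close> satisfies \<open>D(P || Q) \<ge> t \<bar>E\<^sub>P q\<bar> - t\<^sup>2 / 2\<close> for every \<open>t > 0\<close>. Apply this to
  \<open>q(u, z) = \<langle>h(u), g(z)\<rangle> / (\<parallel>h\<parallel> \<parallel>g\<parallel>)\<close>, with \<open>P\<close> the conditional law of \<open>(U, Z)\<close> given \<open>Y = y\<close> and \<open>Q\<close>
  the product of its marginals, under which \<open>q\<close> has mean \<open>0\<close>. Integrating over \<open>y\<close> with the constant
  \<open>t\<close> equal to the ratio \<open>R\<close> gives \<open>I(U; Z | Y) \<ge> R\<^sup>2 - R\<^sup>2 / 2\<close>.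
\<close>

section \<open>Variational lower bound on relative entropy\<close>

lemma rel_entropy_ge:
  fixes q :: "'a \<Rightarrow> real"
  assumes P: "prob_space P" and Q: "prob_space Q" and sets: "sets P = sets Q"
    and q[measurable]: "q \<in> borel_measurable Q" and bd: "AE x in Q. \<bar>q x\<bar> \<le> 1"
    and mean: "(\<integral>x. q x \<partial>Q) = 0" and t: "0 < t"
  shows "ennreal (t * (\<integral>x. q x \<partial>P) - t\<^sup>2 / 2) \<le> rel_entropy P Q"
proof (cases "absolutely_continuous Q P \<and> integrable P (entropy_density (exp 1) Q P)")
  case True
  interpret P: prob_space P by fact
  interpret Q: prob_space Q by fact
  interpret I: interval_bounded_random_variable Q q "-1" 1
    by standard (use bd in \<open>auto elim!: eventually_mono\<close>)
  note [measurable_cong] = sets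
  have ac: "absolutely_continuous Q P" and int: "integrable P (entropy_density (exp 1) Q P)"
    using True by auto
  define f where "f = RN_deriv Q P"
  \<comment> \<open>The tilt \<open>t * q\<close> is shifted by Hoeffding's bound
    \<open>t^2 * (1 - (-1))^2 / 8 = t^2 / 2\<close> on its log-moment generating function. Hence
    \<open>exp s\<close> has \<open>Q\<close>-integral at most 1, and no normalizing constant has to
    be carried along.\<close>
  define s where "s x = t * q x - t\<^sup>2 / 2" for x
  have [measurable]: "f \<in> borel_measurable Q" "s \<in> borel_measurable Q"
    unfolding f_def s_def by measurable
  have dens: "density Q f = P"
    unfolding f_def using Q.density_RN_deriv[OF ac sets] .
  \<comment> \<open>A density vanishes only on a null set of the measure it defines. Together with
    \<open>fin\<close> below, \<open>P\<close>-almost every logarithm of \<open>f\<close> is that of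
    a positive real.\<close>
  have "AE x in density Q f. f x \<noteq> 0"
    by (subst AE_density) auto
  then have pos: "AE x in P. f x \<noteq> 0"
    unfolding dens .
  have fin: "AE x in P. f x \<noteq> \<infinity>"
    using absolutely_continuous_AE[OF sets ac Q.RN_deriv_finite[OF P.sigma_finite_measure_axioms ac sets]]
    unfolding f_def .
  have bdP: "AE x in P. \<bar>q x\<bar> \<le> 1"
    using absolutely_continuous_AE[OF sets ac bd] .
  have "(\<integral>\<^sup>+x. exp (t * q x) \<partial>Q) \<le> ennreal (exp (t\<^sup>2 / 2))"
    using I.Hoeffdings_lemma_nn_integral_0[OF t mean] by simp
  moreover have "(\<integral>\<^sup>+x. ennreal (exp (s x)) \<partial>Q) = ennreal (exp (- t\<^sup>2 / 2)) * (\<integral>\<^sup>+x. exp (t * q x) \<partial>Q)"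
    by (subst nn_integral_cmult[symmetric])
       (auto simp: s_def ennreal_mult[symmetric] exp_add[symmetric] intro!: nn_integral_cong)
  ultimately have "(\<integral>\<^sup>+x. ennreal (exp (s x)) \<partial>Q) \<le> ennreal (exp (- t\<^sup>2 / 2)) * ennreal (exp (t\<^sup>2 / 2))"
    by (simp add: mult_left_mono)
  also have "\<dots> = 1"
    by (simp add: ennreal_mult[symmetric] exp_add[symmetric])
  finally have s1: "(\<integral>\<^sup>+x. ennreal (exp (s x)) \<partial>Q) \<le> 1" .
  have "(\<integral>\<^sup>+x. ennreal (exp (s x) / enn2real (f x)) \<partial>P)
      = (\<integral>\<^sup>+x. f x * ennreal (exp (s x) / enn2real (f x)) \<partial>Q)"
    by (subst dens[symmetric], subst nn_integral_density) auto
  \<comment> \<open>Equality can fail where \<open>f x\<close> is 0 or \<infinity>: there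
    \<open>enn2real (f x) = 0\<close>, division by zero gives 0, and the left side is 0.\<close>
  also have "\<dots> \<le> (\<integral>\<^sup>+x. ennreal (exp (s x)) \<partial>Q)"
  proof (rule nn_integral_mono)
    fix x
    show "f x * ennreal (exp (s x) / enn2real (f x)) \<le> ennreal (exp (s x))"
      by (cases "f x") (auto simp: ennreal_mult[symmetric])
  qed
  also note s1
  finally have r1: "(\<integral>\<^sup>+x. ennreal (exp (s x) / enn2real (f x)) \<partial>P) \<le> 1" .
  have ir: "integrable P (\<lambda>x. exp (s x) / enn2real (f x))"
    by (rule integrableI_nonneg) (use r1 in \<open>auto intro: le_less_trans\<close>)
  have "ennreal (\<integral>x. exp (s x) / enn2real (f x) \<partial>P) \<le> 1"
    using r1 by (subst nn_integral_eq_integral[OF ir, symmetric]) auto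
  then have r2: "(\<integral>x. exp (s x) / enn2real (f x) \<partial>P) \<le> 1"
    by simp
  have iq: "integrable P q"
    by (rule P.integrable_const_bound[of _ 1]) (use bdP in auto)
  have is_int: "integrable P s"
    unfolding s_def using iq by auto
  \<comment> \<open>This integrates \<open>1 + r \<le> exp r\<close> at \<open>r = s - ln f\<close>,
    where \<open>ln f\<close> is the entropy density to base \<open>exp 1\<close>. By
    \<open>r2\<close> the right side is at most 0, so the \<open>P\<close>-mean of \<open>s\<close>
    is at most the divergence.\<close>
  have "(\<integral>x. s x - entropy_density (exp 1) Q P x \<partial>P) \<le> (\<integral>x. exp (s x) / enn2real (f x) - 1 \<partial>P)"
  proof (rule integral_mono_AE)
    show "AE x in P. s x - entropy_density (exp 1) Q P x \<le> exp (s x) / enn2real (f x) - 1"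
      using pos fin
    proof eventually_elim
      case (elim x)
      then have p: "0 < enn2real (f x)"
        by (simp add: enn2real_positive_iff zero_less_iff_neq_zero top.not_eq_extremum)
      have "1 + (s x - ln (enn2real (f x))) \<le> exp (s x - ln (enn2real (f x)))"
        by (rule exp_ge_add_one_self)
      also have "\<dots> = exp (s x) / enn2real (f x)"
        using p by (simp add: exp_diff)
      finally show ?case
        by (simp add: entropy_density_def f_def log_def)
    qed
  qed (use is_int int ir in auto)
  then have "(\<integral>x. s x \<partial>P) - KL_divergence (exp 1) Q P \<le> 0"
    using is_int int ir r2 by (simp add: KL_divergence_def P.prob_space)
  moreover have "(\<integral>x. s x \<partial>P) = t * (\<integral>x. q x \<partial>P) - t\<^sup>2 / 2"
    unfolding s_def using iq by (simp add: P.prob_space)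
  ultimately show ?thesis
    using True by (simp add: rel_entropy_def ennreal_leI)
qed (auto simp: rel_entropy_def)

text \<open>The hypotheses on \<open>q\<close> are invariant under a change of sign; the sign of the
  \<open>P\<close>-mean decides between \<open>q\<close> and \<open>-q\<close>.\<close>

corollary rel_entropy_ge_abs:
  fixes q :: "'a \<Rightarrow> real"
  assumes "prob_space P" and "prob_space Q" and "sets P = sets Q"
    and q: "q \<in> borel_measurable Q" and "AE x in Q. \<bar>q x\<bar> \<le> 1"
    and "(\<integral>x. q x \<partial>Q) = 0" and "0 < t"
  shows "ennreal (t * \<bar>\<integral>x. q x \<partial>P\<bar> - t\<^sup>2 / 2) \<le> rel_entropy P Q"
proof -
  have "(\<lambda>x. - q x) \<in> borel_measurable Q"
    using q by simp
  then show ?thesis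
    using rel_entropy_ge[of P Q q t] rel_entropy_ge[of P Q "\<lambda>x. - q x" t] assms
    by (cases "0 \<le> (\<integral>x. q x \<partial>P)") auto
qed

section \<open>Disintegration along \<open>Y\<close>\<close>

text \<open>Turns the defining identity of \<open>cond_law\<close>, which speaks of sets, into an
  equality of measures, so that the rules for \<open>bind\<close> reach integrals of functions and
  null sets. The restriction to \<open>B\<close> serves to test conditional expectations on the
  events \<open>Y \<in> B\<close>.\<close>

lemma cond_law_bind:
  assumes Y[measurable]: "Y \<in> borel_measurable M" and W[measurable]: "W \<in> borel_measurable M"
    and \<kappa>: "cond_law M W Y \<kappa>" and B[measurable]: "B \<in> sets borel"
  shows "density (distr M borel Y) (indicator B) \<bind> \<kappa>
    = distr (density M (\<lambda>\<omega>. indicator B (Y \<omega>))) borel W"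
proof (rule measure_eqI)
  have \<kappa>m: "\<kappa> \<in> borel \<rightarrow>\<^sub>M subprob_algebra borel"
    using \<kappa> by (auto simp: cond_law_def intro: measurable_prob_algebraD)
  then have \<kappa>m'[measurable]: "\<kappa> \<in> density (distr M borel Y) (indicator B) \<rightarrow>\<^sub>M subprob_algebra borel"
    by simp
  have s: "sets (density (distr M borel Y) (indicator B) \<bind> \<kappa>) = sets borel"
    by (rule sets_bind) (use sets_kernel[OF \<kappa>m'] in auto)
  then show "sets (density (distr M borel Y) (indicator B) \<bind> \<kappa>)
      = sets (distr (density M (\<lambda>\<omega>. indicator B (Y \<omega>))) borel W)"
    by simp
  fix A assume "A \<in> sets (density (distr M borel Y) (indicator B) \<bind> \<kappa>)"
  then have A[measurable]: "A \<in> sets borel"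
    unfolding s .
  have em[measurable]: "(\<lambda>y. emeasure (\<kappa> y) A) \<in> borel_measurable borel"
    using \<kappa>m by measurable
  have "emeasure (density (distr M borel Y) (indicator B) \<bind> \<kappa>) A = (\<integral>\<^sup>+y\<in>B. emeasure (\<kappa> y) A \<partial>distr M borel Y)"
    by (subst emeasure_bind[OF _ \<kappa>m' A]) (auto simp: nn_integral_density mult.commute)
  also have "\<dots> = emeasure M {\<omega> \<in> space M. W \<omega> \<in> A \<and> Y \<omega> \<in> B}"
    using \<kappa> A B by (simp add: cond_law_def)
  also have "\<dots> = (\<integral>\<^sup>+\<omega>. indicator {\<omega> \<in> space M. W \<omega> \<in> A \<and> Y \<omega> \<in> B} \<omega> \<partial>M)"
    by (subst nn_integral_indicator) auto
  also have "\<dots> = (\<integral>\<^sup>+\<omega>. indicator B (Y \<omega>) * indicator (W -` A \<inter> space M) \<omega> \<partial>M)"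
    by (intro nn_integral_cong) (auto simp: indicator_def)
  also have "\<dots> = emeasure (distr (density M (\<lambda>\<omega>. indicator B (Y \<omega>))) borel W) A"
    by (subst emeasure_distr) (auto simp: emeasure_density)
  finally show "emeasure (density (distr M borel Y) (indicator B) \<bind> \<kappa>) A
      = emeasure (distr (density M (\<lambda>\<omega>. indicator B (Y \<omega>))) borel W) A" .
qed

text \<open>For \<open>B = UNIV\<close> the mixture of the kernels is the law of \<open>W\<close>,
  and a property holds almost everywhere for a mixture iff it does so for almost every
  kernel.\<close>

lemma AE_cond_law:
  assumes Y[measurable]: "Y \<in> borel_measurable M" and W[measurable]: "W \<in> borel_measurable M"
    and \<kappa>: "cond_law M W Y \<kappa>"
    and P[measurable]: "Measurable.pred borel P" and AE: "AE \<omega> in M. P (W \<omega>)"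
  shows "AE y in distr M borel Y. AE x in \<kappa> y. P x"
proof -
  have \<kappa>m: "\<kappa> \<in> density (distr M borel Y) (indicator UNIV) \<rightarrow>\<^sub>M subprob_algebra borel"
    using \<kappa> by (auto simp: cond_law_def intro: measurable_prob_algebraD)
  have "AE x in density (distr M borel Y) (indicator UNIV) \<bind> \<kappa>. P x"
    unfolding cond_law_bind[OF Y W \<kappa> sets.top[of borel, unfolded space_borel]]
    using AE by (subst AE_distr_iff) (auto simp: AE_density)
  then show ?thesis
    by (simp add: AE_bind[OF \<kappa>m P] AE_density)
qed

text \<open>The kernel average is a function of \<open>Y\<close>, hence measurable for the
  \<sigma>-algebra of \<open>Y\<close>. It remains to compare integrals over the sets of that
  \<sigma>-algebra, which are exactly the events \<open>Y \<in> B\<close>.\<close>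

lemma real_cond_exp_cond_law:
  fixes k :: "'a::topological_space \<Rightarrow> real"
  assumes M: "prob_space M"
    and Y[measurable]: "Y \<in> borel_measurable M" and W[measurable]: "W \<in> borel_measurable M"
    and \<kappa>: "cond_law M W Y \<kappa>"
    and k[measurable]: "k \<in> borel_measurable borel" and bd: "\<And>x. \<bar>k x\<bar> \<le> C"
  shows "AE \<omega> in M. real_cond_exp M (sigma_gen M Y) (\<lambda>\<omega>. k (W \<omega>)) \<omega> = (\<integral>x. k x \<partial>\<kappa> (Y \<omega>))"
proof -
  interpret prob_space M by fact
  have \<kappa>p: "\<kappa> \<in> borel \<rightarrow>\<^sub>M prob_algebra borel"
    using \<kappa> by (simp add: cond_law_def)
  note \<kappa>m[measurable] = measurable_prob_algebraD[OF \<kappa>p]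
  have prob: "prob_space (\<kappa> y)" and sets[simp]: "sets (\<kappa> y) = sets borel" for y
    using measurable_space[OF \<kappa>p, of y] by (auto simp: space_prob_algebra)
  have [measurable]: "(\<lambda>y. \<integral>x. k x \<partial>\<kappa> y) \<in> borel_measurable borel"
    by measurable
  have bd\<kappa>: "\<bar>\<integral>x. k x \<partial>\<kappa> y\<bar> \<le> C" for y
  proof -
    interpret K: prob_space "\<kappa> y" by (rule prob)
    have ik: "integrable (\<kappa> y) k"
      by (rule K.integrable_const_bound[of _ C]) (auto simp: bd cong: measurable_cong_sets)
    have "(\<integral>x. k x \<partial>\<kappa> y) \<le> C" "-C \<le> (\<integral>x. k x \<partial>\<kappa> y)"
      using K.integral_le_const[OF ik, of C] K.integral_ge_const[OF ik, of "-C"] bd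
      by (auto simp: abs_le_iff minus_le_iff)
    then show ?thesis by auto
  qed
  have sub: "subalgebra M (sigma_gen M Y)"
    using sets_image_in_sets[OF refl Y] by (auto simp: subalgebra_def)
  interpret finite_measure_subalgebra M "sigma_gen M Y"
    by standard (rule sub)
  show ?thesis
  proof (rule real_cond_exp_charact)
    fix A assume "A \<in> sets (sigma_gen M Y)"
    then obtain B where B[measurable]: "B \<in> sets borel" and A: "A = Y -` B \<inter> space M"
      by (auto simp: sets_vimage_algebra2)
    have m: "\<kappa> \<in> density (distr M borel Y) (indicator B) \<rightarrow>\<^sub>M subprob_algebra borel"
      by simp
    have fin: "finite_measure (density (distr M borel Y) (indicator B))"
      by (rule finite_measureI)
         (auto simp: emeasure_density emeasure_distr B intro!: nn_integral_indicator)
    have "(\<integral>\<omega>\<in>A. k (W \<omega>) \<partial>M) = (\<integral>\<omega>. indicator B (Y \<omega>) * k (W \<omega>) \<partial>M)"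
      unfolding set_lebesgue_integral_def A
      by (intro Bochner_Integration.integral_cong) (auto simp: indicator_def)
    also have "\<dots> = (\<integral>x. k x \<partial>distr (density M (\<lambda>\<omega>. ennreal (indicator B (Y \<omega>)))) borel W)"
      by (subst integral_distr) (auto simp: integral_density)
    also have "\<dots> = (\<integral>x. k x \<partial>(density (distr M borel Y) (indicator B) \<bind> \<kappa>))"
      unfolding cond_law_bind[OF Y W \<kappa> B] by (simp add: ennreal_indicator)
    \<comment> \<open>Fubini for a mixture: the bound \<open>C\<close> on \<open>k\<close> and the
      kernel mass 1, over a finite mixing measure, ensure integrability.\<close>
    also have "\<dots> = (\<integral>y. (\<integral>x. k x \<partial>\<kappa> y) \<partial>density (distr M borel Y) (indicator B))"
      by (rule integral_bind[OF k _ m fin, of C 1])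
         (auto simp: bd prob_space.emeasure_space_1[OF prob])
    also have "\<dots> = (\<integral>y. (\<integral>x. k x \<partial>\<kappa> y) \<partial>density (distr M borel Y) (\<lambda>y. ennreal (indicator B y)))"
      by (simp add: ennreal_indicator)
    also have "\<dots> = (\<integral>\<omega>. indicator B (Y \<omega>) * (\<integral>x. k x \<partial>\<kappa> (Y \<omega>)) \<partial>M)"
      by (subst integral_density) (auto simp: integral_distr)
    also have "\<dots> = (\<integral>\<omega>\<in>A. (\<integral>x. k x \<partial>\<kappa> (Y \<omega>)) \<partial>M)"
      unfolding set_lebesgue_integral_def A
      by (intro Bochner_Integration.integral_cong) (auto simp: indicator_def)
    finally show "(\<integral>\<omega>\<in>A. k (W \<omega>) \<partial>M) = (\<integral>\<omega>\<in>A. (\<integral>x. k x \<partial>\<kappa> (Y \<omega>)) \<partial>M)" .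
  next
    show "integrable M (\<lambda>\<omega>. k (W \<omega>))"
      by (rule integrable_const_bound[of _ C]) (auto simp: bd)
    show "integrable M (\<lambda>\<omega>. \<integral>x. k x \<partial>\<kappa> (Y \<omega>))"
      by (rule integrable_const_bound[of _ C]) (auto simp: bd\<kappa>)
    show "(\<lambda>\<omega>. \<integral>x. k x \<partial>\<kappa> (Y \<omega>)) \<in> borel_measurable (sigma_gen M Y)"
      by (rule measurable_compose[OF measurable_vimage_algebra1]) auto
  qed
qed

section \<open>Essential suprema and truncated integrals\<close>

text \<open>\<open>real_of_ereal\<close> sends both infinities to 0, so a nonzero value certifies
  that the essential supremum is finite and equal to \<open>Linf_norm\<close>.\<close>

lemma AE_norm_le_Linf_norm:
  assumes "Linf_norm M V \<noteq> 0"
  shows "AE \<omega> in M. norm (V \<omega>) \<le> Linf_norm M V"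
proof -
  have "\<bar>esssup M (\<lambda>\<omega>. ereal (norm (V \<omega>)))\<bar> \<noteq> \<infinity>"
    using assms by (auto simp: Linf_norm_def)
  then have eq: "ereal (Linf_norm M V) = esssup M (\<lambda>\<omega>. ereal (norm (V \<omega>)))"
    by (simp add: Linf_norm_def ereal_real)
  show ?thesis
    using esssup_AE[of "\<lambda>\<omega>. ereal (norm (V \<omega>))" M]
    unfolding eq[symmetric] by simp
qed

lemma (in prob_space) Linf_norm_pos:
  assumes "Linf_norm M V \<noteq> 0"
  shows "0 < Linf_norm M V"
proof -
  have "AE \<omega> in M. 0 \<le> Linf_norm M V"
    using AE_norm_le_Linf_norm[OF assms] by eventually_elim (rule order_trans[OF norm_ge_zero])
  then show ?thesis
    using assms by (simp add: AE_const)
qed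

text \<open>\<open>ennreal\<close> cuts negative values off at 0, so the right side integrates the
  positive part, from which the Bochner integral still subtracts the negative part.\<close>

lemma ennreal_integral_le_nn_integral:
  fixes f :: "'a \<Rightarrow> real"
  assumes "integrable M f"
  shows "ennreal (\<integral>x. f x \<partial>M) \<le> (\<integral>\<^sup>+x. ennreal (f x) \<partial>M)"
proof -
  have fin: "(\<integral>\<^sup>+x. ennreal (f x) \<partial>M) < \<infinity>"
    using assms by (auto simp: real_integrable_def less_top)
  have "(\<integral>x. f x \<partial>M) \<le> enn2real (\<integral>\<^sup>+x. ennreal (f x) \<partial>M)"
    using real_lebesgue_integral_def[OF assms] by (simp add: enn2real_nonneg)
  then have "ennreal (\<integral>x. f x \<partial>M) \<le> ennreal (enn2real (\<integral>\<^sup>+x. ennreal (f x) \<partial>M))"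
    by (rule ennreal_leI)
  also have "\<dots> = (\<integral>\<^sup>+x. ennreal (f x) \<partial>M)"
    using fin by (intro ennreal_enn2real) simp
  finally show ?thesis .
qed

lemma borel_measurable_vec_component [measurable (raw)]:
  fixes f :: "'a \<Rightarrow> real^'n"
  assumes "f \<in> borel_measurable M"
  shows "(\<lambda>x. f x $ i) \<in> borel_measurable M"
  using borel_measurable_inner[OF assms borel_measurable_const[of "axis i 1"]] by (simp add: inner_axis)

section \<open>The bound for one pair of test functions\<close>

text \<open>Stated for every version \<open>\<kappa>\<close>, so that the infimum in
  \<open>cond_mutual_info\<close> can be taken afterwards.\<close>

lemma cond_corr_ratio_sq_le:
  fixes U :: "'w \<Rightarrow> 'u::second_countable_topology" and Z :: "'w \<Rightarrow> 'z::second_countable_topology"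
    and Y :: "'w \<Rightarrow> 'y::second_countable_topology"
    and h :: "'u \<Rightarrow> real^'d" and g :: "'z \<Rightarrow> real^'d"
  assumes M: "prob_space M"
    and [measurable]: "U \<in> borel_measurable M" "Z \<in> borel_measurable M"
    and Y[measurable]: "Y \<in> borel_measurable M"
    and \<kappa>: "cond_law M (\<lambda>\<omega>. (U \<omega>, Z \<omega>)) Y \<kappa>"
    and hg: "(h, g) \<in> test_pairs M U Y Z"
  shows "ennreal ((cond_corr_ratio M U Y Z h g)\<^sup>2 / 2)
    \<le> (\<integral>\<^sup>+y. rel_entropy (\<kappa> y) (distr (\<kappa> y) borel fst \<Otimes>\<^sub>M distr (\<kappa> y) borel snd) \<partial>distr M borel Y)"
proof -
  interpret prob_space M by fact
  interpret \<nu>: prob_space "distr M borel Y"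
    by (rule prob_space_distr) simp
  define H where "H = Linf_norm M (\<lambda>\<omega>. h (U \<omega>))"
  define G where "G = Linf_norm M (\<lambda>\<omega>. g (Z \<omega>))"
  define R where "R = cond_corr_ratio M U Y Z h g"
  have [measurable]: "h \<in> borel_measurable borel" "g \<in> borel_measurable borel"
    and bdd: "bounded (range h)" "bounded (range g)"
    and mean: "AE \<omega> in M. vec_cond_exp M (sigma_gen M Y) (\<lambda>\<omega>'. g (Z \<omega>')) \<omega> = 0"
    and HG0: "H \<noteq> 0" "G \<noteq> 0"
    using hg by (auto simp: test_pairs_def H_def G_def)
  have HG: "0 < H" "0 < G"
    using HG0 by (auto simp: H_def G_def intro!: Linf_norm_pos)
  \<comment> \<open>\<open>Ch\<close> and \<open>Cg\<close> bound everywhere and serve integrability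
    and the evaluation of conditional expectations. The norms \<open>H\<close> and \<open>G\<close>
    bound only almost everywhere, but they give the sharp constant 1 for \<open>q\<close>.\<close>
  obtain Ch where Ch: "norm (h u) \<le> Ch" for u
    using bdd(1) by (auto simp: bounded_iff)
  obtain Cg where Cg: "norm (g z) \<le> Cg" for z
    using bdd(2) by (auto simp: bounded_iff)
  \<comment> \<open>Second countability identifies the Borel \<sigma>-algebra of the product with
    the product of the Borel \<sigma>-algebras.\<close>
  have W[measurable]: "(\<lambda>\<omega>. (U \<omega>, Z \<omega>)) \<in> borel_measurable M"
    unfolding borel_prod[symmetric] by measurable
  have fst[measurable]: "(fst :: 'u \<times> 'z \<Rightarrow> 'u) \<in> borel_measurable borel"
    and snd[measurable]: "(snd :: 'u \<times> 'z \<Rightarrow> 'z) \<in> borel_measurable borel"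
    unfolding borel_prod[symmetric] by measurable
  have \<kappa>p: "\<kappa> \<in> borel \<rightarrow>\<^sub>M prob_algebra borel"
    using \<kappa> by (simp add: cond_law_def)
  note \<kappa>m[measurable] = measurable_prob_algebraD[OF \<kappa>p]
  have prob: "prob_space (\<kappa> y)" and sets\<kappa>[measurable_cong]: "sets (\<kappa> y) = sets borel" for y
    using measurable_space[OF \<kappa>p, of y] by (auto simp: space_prob_algebra)
  define q where "q x = (h (fst x) \<bullet> g (snd x)) / (H * G)" for x
  have q[measurable]: "q \<in> borel_measurable borel"
    unfolding q_def by measurable
  have bq: "\<bar>h (fst x) \<bullet> g (snd x)\<bar> \<le> Ch * Cg" for x
    using Cauchy_Schwarz_ineq2[of "h (fst x)" "g (snd x)"]
      mult_mono[OF Ch[of "fst x"] Cg[of "snd x"]] norm_ge_zero[of "h (fst x)"] Ch[of "fst x"]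
    by (smt (verit) norm_ge_zero)
  have bq': "\<bar>q x\<bar> \<le> Ch * Cg / (H * G)" for x
    using bq[of x] HG by (simp add: q_def abs_mult divide_right_mono)
  have ce: "AE \<omega> in M. real_cond_exp M (sigma_gen M Y) (\<lambda>\<omega>'. h (U \<omega>') \<bullet> g (Z \<omega>')) \<omega>
      = (\<integral>x. h (fst x) \<bullet> g (snd x) \<partial>\<kappa> (Y \<omega>))"
    using real_cond_exp_cond_law[OF M Y W \<kappa>, of "\<lambda>x. h (fst x) \<bullet> g (snd x)", OF _ bq] by simp
  \<comment> \<open>The conditional expectation is evaluated through \<open>\<kappa>\<close> and the
    outer expectation moved to the law of \<open>Y\<close>, so \<open>R\<close> becomes the average
    over \<open>y\<close> of the absolute kernel means of \<open>q\<close>.\<close>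
  have R: "R = (\<integral>y. \<bar>\<integral>x. q x \<partial>\<kappa> y\<bar> \<partial>distr M borel Y)"
  proof -
    have "(\<integral>\<omega>. \<bar>real_cond_exp M (sigma_gen M Y) (\<lambda>\<omega>'. h (U \<omega>') \<bullet> g (Z \<omega>')) \<omega>\<bar> \<partial>M)
        = (\<integral>\<omega>. \<bar>\<integral>x. h (fst x) \<bullet> g (snd x) \<partial>\<kappa> (Y \<omega>)\<bar> \<partial>M)"
      by (rule integral_cong_AE) (use ce in \<open>auto elim!: eventually_mono\<close>)
    then have "R = (\<integral>\<omega>. \<bar>\<integral>x. q x \<partial>\<kappa> (Y \<omega>)\<bar> \<partial>M)"
      using HG by (simp add: R_def cond_corr_ratio_def q_def H_def[symmetric] G_def[symmetric] abs_mult)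
    then show ?thesis
      by (subst integral_distr) auto
  qed
  have meanY: "AE y in distr M borel Y. \<forall>i. (\<integral>x. g (snd x) $ i \<partial>\<kappa> y) = 0"
  proof -
    have "AE y in distr M borel Y. (\<integral>x. g (snd x) $ i \<partial>\<kappa> y) = 0" for i
    proof -
      have bound: "\<bar>g (snd x) $ i\<bar> \<le> Cg" for x :: "'u \<times> 'z"
        using component_le_norm_cart[of "g (snd x)" i] Cg[of "snd x"] by simp
      from real_cond_exp_cond_law[OF M Y W \<kappa>, of "\<lambda>x. g (snd x) $ i", OF _ bound]
      have "AE \<omega> in M. real_cond_exp M (sigma_gen M Y) (\<lambda>\<omega>. g (Z \<omega>) $ i) \<omega> = (\<integral>x. g (snd x) $ i \<partial>\<kappa> (Y \<omega>))"
        by simp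
      with mean have "AE \<omega> in M. (\<integral>x. g (snd x) $ i \<partial>\<kappa> (Y \<omega>)) = 0"
        by eventually_elim (simp add: vec_cond_exp_def vec_eq_iff)
      then show ?thesis
        by (subst AE_distr_iff) auto
    qed
    \<comment> \<open>There are finitely many coordinates, so their exceptional null sets unite to a
      null set.\<close>
    then show ?thesis
      by (simp add: AE_all_countable)
  qed
  have bh: "AE y in distr M borel Y. AE x in \<kappa> y. norm (h (fst x)) \<le> H"
    by (rule AE_cond_law[OF Y W \<kappa>])
       (use AE_norm_le_Linf_norm[of M "\<lambda>\<omega>. h (U \<omega>)"] HG0 in \<open>auto simp: H_def\<close>)
  have bg: "AE y in distr M borel Y. AE x in \<kappa> y. norm (g (snd x)) \<le> G"
    by (rule AE_cond_law[OF Y W \<kappa>])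
       (use AE_norm_le_Linf_norm[of M "\<lambda>\<omega>. g (Z \<omega>)"] HG0 in \<open>auto simp: G_def\<close>)
  show ?thesis
  \<comment> \<open>The entropy bound is used with \<open>t = R\<close> and asks for
    \<open>t > 0\<close>; for \<open>R = 0\<close> the left side of the claim is 0.\<close>
  proof (cases "0 < R")
    case True
    have D: "AE y in distr M borel Y. ennreal (R * \<bar>\<integral>x. q x \<partial>\<kappa> y\<bar> - R\<^sup>2 / 2)
        \<le> rel_entropy (\<kappa> y) (distr (\<kappa> y) borel fst \<Otimes>\<^sub>M distr (\<kappa> y) borel snd)"
      using meanY bh bg
    proof eventually_elim
      case (elim y)
      interpret K: prob_space "\<kappa> y" by (rule prob)
      let ?P = "distr (\<kappa> y) borel fst" and ?Q = "distr (\<kappa> y) borel snd"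
      interpret P: prob_space ?P by (rule K.prob_space_distr) measurable
      interpret Q: prob_space ?Q by (rule K.prob_space_distr) measurable
      interpret PQ: pair_prob_space ?P ?Q ..
      have sPQ[measurable_cong]: "sets (?P \<Otimes>\<^sub>M ?Q) = sets borel"
        by (simp add: borel_prod[symmetric] cong: sets_pair_measure_cong)
      \<comment> \<open>Each bound concerns a single coordinate, so it passes from
        \<open>\<kappa> y\<close> to the corresponding marginal and from there to the product
        measure.\<close>
      have "AE x in ?P \<Otimes>\<^sub>M ?Q. norm (h (fst x)) \<le> H \<and> norm (g (snd x)) \<le> G"
      proof (rule PQ.AE_pair_measure)
        show "{x \<in> space (?P \<Otimes>\<^sub>M ?Q). norm (h (fst x)) \<le> H \<and> norm (g (snd x)) \<le> G} \<in> sets (?P \<Otimes>\<^sub>M ?Q)"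
          by measurable
        have hH: "AE u in ?P. norm (h u) \<le> H" and gG: "AE z in ?Q. norm (g z) \<le> G"
          using elim by (simp_all add: AE_distr_iff)
        show "AE u in ?P. AE z in ?Q. norm (h (fst (u, z))) \<le> H \<and> norm (g (snd (u, z))) \<le> G"
          using hH by eventually_elim (use gG in \<open>auto elim: eventually_mono\<close>)
      qed
      then have b1: "AE x in ?P \<Otimes>\<^sub>M ?Q. \<bar>q x\<bar> \<le> 1"
      proof eventually_elim
        case (elim x)
        have "\<bar>h (fst x) \<bullet> g (snd x)\<bar> \<le> norm (h (fst x)) * norm (g (snd x))"
          by (rule Cauchy_Schwarz_ineq2)
        also have "\<dots> \<le> H * G"
          using elim HG by (intro mult_mono) auto
        finally show ?case
          using HG by (simp add: q_def abs_mult divide_le_eq)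
      qed
      have ig: "integrable ?Q g"
        by (rule Q.integrable_const_bound[of _ Cg]) (auto simp: Cg)
      have g0: "(\<integral>z. g z \<partial>?Q) = 0"
      proof (rule vec_eq_iff[THEN iffD2], rule allI)
        fix i
        have "(\<integral>z. g z \<partial>?Q) $ i = (\<integral>z. g z \<partial>?Q) \<bullet> axis i 1"
          by (simp add: inner_axis)
        also have "\<dots> = (\<integral>z. g z \<bullet> axis i 1 \<partial>?Q)"
          using ig by simp
        also have "\<dots> = (\<integral>x. g (snd x) $ i \<partial>\<kappa> y)"
          by (subst integral_distr) (simp_all add: inner_axis sets\<kappa> cong: measurable_cong_sets)
        finally show "(\<integral>z. g z \<partial>?Q) $ i = 0 $ i"
          using elim by simp
      qed
      have iq: "integrable (?P \<Otimes>\<^sub>M ?Q) q"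
        by (rule PQ.integrable_const_bound[of _ 1]) (use b1 in auto)
      \<comment> \<open>For fixed \<open>u\<close> the inner integral is \<open>h u\<close> paired
        with the mean of \<open>g\<close>, divided by \<open>H * G\<close>, and that mean is 0 by
        \<open>g0\<close>.\<close>
      have "(\<integral>x. q x \<partial>(?P \<Otimes>\<^sub>M ?Q)) = (\<integral>u. (\<integral>z. q (u, z) \<partial>?Q) \<partial>?P)"
        by (rule PQ.integral_fst'[OF iq, symmetric])
      also have "\<dots> = 0"
        using ig by (simp add: q_def g0)
      finally have m0: "(\<integral>x. q x \<partial>(?P \<Otimes>\<^sub>M ?Q)) = 0" .
      show ?case
      proof (rule rel_entropy_ge_abs[OF K.prob_space_axioms PQ.prob_space_axioms _ _ b1 m0 True])
        show "sets (\<kappa> y) = sets (?P \<Otimes>\<^sub>M ?Q)"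
          by (simp only: sPQ sets\<kappa>)
        show "q \<in> borel_measurable (?P \<Otimes>\<^sub>M ?Q)"
          by measurable
      qed
    qed
    have bd\<kappa>: "\<bar>\<integral>x. q x \<partial>\<kappa> y\<bar> \<le> Ch * Cg / (H * G)" for y
    proof -
      interpret K: prob_space "\<kappa> y" by (rule prob)
      have ik: "integrable (\<kappa> y) q"
        by (rule K.integrable_const_bound[of _ "Ch * Cg / (H * G)"]) (use bq' in auto)
      have "(\<integral>x. q x \<partial>\<kappa> y) \<le> Ch * Cg / (H * G)" "-(Ch * Cg / (H * G)) \<le> (\<integral>x. q x \<partial>\<kappa> y)"
        using K.integral_le_const[OF ik, of "Ch * Cg / (H * G)"]
          K.integral_ge_const[OF ik, of "- (Ch * Cg / (H * G))"] bq'
        by (auto simp only: abs_le_iff minus_le_iff)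
      then show ?thesis by auto
    qed
    have iy: "integrable (distr M borel Y) (\<lambda>y. \<bar>\<integral>x. q x \<partial>\<kappa> y\<bar>)"
      by (rule \<nu>.integrable_const_bound[of _ "Ch * Cg / (H * G)"]) (use bd\<kappa> in auto)
    \<comment> \<open>The kernel means average to \<open>R\<close>, so a constant \<open>t\<close>
      yields \<open>t * R - t^2 / 2\<close>; \<open>t = R\<close> maximizes this, with value
      \<open>R^2 / 2\<close>.\<close>
    have "ennreal (R\<^sup>2 / 2) = ennreal (\<integral>y. R * \<bar>\<integral>x. q x \<partial>\<kappa> y\<bar> - R\<^sup>2 / 2 \<partial>distr M borel Y)"
      using iy R[symmetric] \<nu>.prob_space by (simp add: power2_eq_square)
    \<comment> \<open>The integrand is negative at those \<open>y\<close> whose absolute kernel mean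
      is below \<open>R / 2\<close>; truncating at 0 only enlarges the integral.\<close>
    also have "\<dots> \<le> (\<integral>\<^sup>+y. ennreal (R * \<bar>\<integral>x. q x \<partial>\<kappa> y\<bar> - R\<^sup>2 / 2) \<partial>distr M borel Y)"
      by (rule ennreal_integral_le_nn_integral) (use iy in auto)
    also have "\<dots> \<le> (\<integral>\<^sup>+y. rel_entropy (\<kappa> y) (distr (\<kappa> y) borel fst \<Otimes>\<^sub>M distr (\<kappa> y) borel snd) \<partial>distr M borel Y)"
      by (rule nn_integral_mono_AE[OF D])
    finally show ?thesis
      unfolding R_def .
  next
    case False
    have "0 \<le> R"
      unfolding R by simp
    with False have "R = 0"
      by simp
    then show ?thesis
      by (simp add: R_def)
  qed
qed

section \<open>Passage to the supremum and to the two kinds of predictor\<close>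

lemma cond_corr_sup_le:
  fixes U :: "'w \<Rightarrow> 'u::second_countable_topology" and Z :: "'w \<Rightarrow> 'z::second_countable_topology"
    and Y :: "'w \<Rightarrow> 'y::second_countable_topology"
  assumes "prob_space M"
    and "U \<in> borel_measurable M" "Z \<in> borel_measurable M" "Y \<in> borel_measurable M"
    and fin: "cond_mutual_info M U Z Y < \<infinity>"
  shows "cond_corr_sup TYPE('d::finite) M U Y Z \<le> ennreal (sqrt (2 * enn2real (cond_mutual_info M U Z Y)))"
  unfolding cond_corr_sup_def
proof (rule SUP_least, clarify)
  fix h :: "'u \<Rightarrow> real^'d" and g :: "'z \<Rightarrow> real^'d"
  assume hg: "(h, g) \<in> test_pairs M U Y Z"
  let ?R = "cond_corr_ratio M U Y Z h g"
  have "ennreal (?R\<^sup>2 / 2) \<le> cond_mutual_info M U Z Y"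
    unfolding cond_mutual_info_def using assms hg
    by (intro INF_greatest cond_corr_ratio_sq_le) auto
  \<comment> \<open>Finiteness matters here, because \<open>enn2real\<close> sends \<infinity> to
    0.\<close>
  then have "?R\<^sup>2 / 2 \<le> enn2real (cond_mutual_info M U Z Y)"
    using fin by (cases "cond_mutual_info M U Z Y") auto
  then have "?R\<^sup>2 \<le> 2 * enn2real (cond_mutual_info M U Z Y)"
    by simp
  then show "ennreal ?R \<le> ennreal (sqrt (2 * enn2real (cond_mutual_info M U Z Y)))"
    by (intro ennreal_leI real_le_rsqrt)
qed

theorem theorem2p5:
  fixes M :: "'w measure"
    and X :: "'w \<Rightarrow> 'x::polish_space"
    and Y :: "'w \<Rightarrow> 'y::polish_space"
    and Z :: "'w \<Rightarrow> 'z::polish_space"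
  assumes "prob_space M"
    and "X \<in> borel_measurable M" and "Y \<in> borel_measurable M" and "Z \<in> borel_measurable M"
  shows "(\<forall>U::'w \<Rightarrow> 'y.
            deterministic_predictor M X Z U \<and> admissible M U Y Z \<longrightarrow>
            cond_corr_sup TYPE('d::finite) M U Y Z \<le> ennreal (sqrt (2 * enn2real (cond_mutual_info M U Z Y)))) \<and>
         (\<forall>U::'w \<Rightarrow> 'n::polish_space \<times> 'y.
            revealed_randomized_predictor M X Y Z U \<and> admissible M U Y Z \<longrightarrow>
            cond_corr_sup TYPE('d) M U Y Z \<le> ennreal (sqrt (2 * enn2real (cond_mutual_info M U Z Y))))"
proof (intro conjI allI impI; elim conjE)
  note [measurable] = assms(2-4)
  fix U :: "'w \<Rightarrow> 'y"
  assume "deterministic_predictor M X Z U" and adm: "admissible M U Y Z"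
  then obtain f :: "'x \<times> 'z \<Rightarrow> 'y" where [measurable]: "f \<in> borel_measurable borel"
    and U: "\<And>\<omega>. \<omega> \<in> space M \<Longrightarrow> U \<omega> = f (X \<omega>, Z \<omega>)"
    by (auto simp: deterministic_predictor_def)
  have [measurable]: "(\<lambda>\<omega>. (X \<omega>, Z \<omega>)) \<in> borel_measurable M"
    unfolding borel_prod[symmetric] by measurable
  \<comment> \<open>The form of the predictor makes \<open>U\<close> a composition of measurable
    maps, and admissibility supplies the finiteness of the conditional information.\<close>
  have "U \<in> borel_measurable M"
    by (subst measurable_cong[OF U]) auto
  with assms adm show "cond_corr_sup TYPE('d) M U Y Z \<le> ennreal (sqrt (2 * enn2real (cond_mutual_info M U Z Y)))"
    by (intro cond_corr_sup_le) (auto simp: admissible_def)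
next
  note [measurable] = assms(2-4)
  fix U :: "'w \<Rightarrow> 'n \<times> 'y"
  assume "revealed_randomized_predictor M X Y Z U" and adm: "admissible M U Y Z"
  then obtain N :: "'w \<Rightarrow> 'n" and f :: "'x \<times> 'z \<times> 'n \<Rightarrow> 'y"
    where [measurable]: "N \<in> borel_measurable M" "f \<in> borel_measurable borel"
      and U: "\<And>\<omega>. \<omega> \<in> space M \<Longrightarrow> U \<omega> = (N \<omega>, f (X \<omega>, Z \<omega>, N \<omega>))"
    by (auto simp: revealed_randomized_predictor_def)
  have [measurable]: "(\<lambda>\<omega>. (X \<omega>, Z \<omega>, N \<omega>)) \<in> borel_measurable M"
    unfolding borel_prod[symmetric] by measurable
  have "(\<lambda>\<omega>. (N \<omega>, f (X \<omega>, Z \<omega>, N \<omega>))) \<in> borel_measurable M"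
    unfolding borel_prod[symmetric] by measurable
  then have "U \<in> borel_measurable M"
    by (subst measurable_cong[OF U]) auto
  with assms adm show "cond_corr_sup TYPE('d) M U Y Z \<le> ennreal (sqrt (2 * enn2real (cond_mutual_info M U Z Y)))"
    by (intro cond_corr_sup_le) (auto simp: admissible_def)
qed

end
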